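(* There exist a complex Hilbert space $\mathbb{H}$ and a hyperbolic invertible bounded linear operator $T$ on $\mathbb{H}$ such that the sequence of Aluthge iterates $\{\Delta^{(n)}(T)\}_{n\ge1}$ does not converge in the operator norm.
   Context: - An invertible bounded linear operator $T$ is hyperbolic if $\sigma(T)\cap\mathbb{T}=\varnothing$, where $\sigma(T)$ is the spectrum and $\mathbb{T}=\{z\in\mathbb{C}:|z|=1\}$. - For $T\in B(\mathbb{H})$ let $T=U|T|$ be the polar decomposition, where $|T|=(T^*T)^{1/2}$ and $U$ is the unique partial isometry with $\ker U=\ker T=\ker|T|$. The Aluthge transform is $\Delta(T)=|T|^{1/2}U|T|^{1/2}$, and the Aluthge iterates are $\Delta^{(0)}(T)=T$, $\Delta^{(n)}(T)=\Delta(\Delta^{(n-1)}(T))$ for $n\ge1$. *)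

theory Defs
  imports "HOL-Analysis.Analysis" "HOL-Algebra.Module" "HOL-Algebra.Algebraic_Closure_Type"
begin

text \<open>
  Complex Hilbert spaces are carrier-based, so that one can quantify over them inside a formula.
  The vector space structure is a HOL-Algebra module over the field of complex numbers (the fields
  \<open>mult\<close> and \<open>one\<close> which the module record inherits from rings play no role), extended by an inner
  product. The inner product is linear in its first argument.
\<close>

record 'a complex_inner_module = "(complex, 'a) module" +
  iprod :: "'a \<Rightarrow> 'a \<Rightarrow> complex"

definition hnorm :: "'a complex_inner_module \<Rightarrow> 'a \<Rightarrow> real" where
  "hnorm H x = sqrt (Re (iprod H x x))"

text \<open>The value 0 outside the carrier is only there because the library's metric space locale
  requires symmetry and nonnegativity of the distance on the whole type.\<close>

definition hdist :: "'a complex_inner_module \<Rightarrow> 'a \<Rightarrow> 'a \<Rightarrow> real" where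
  "hdist H x y =
     (if x \<in> carrier H \<and> y \<in> carrier H then hnorm H (x \<ominus>\<^bsub>H\<^esub> y) else 0)"

locale complex_inner_space =
  module "ring_of_type_algebra :: complex ring" H for H :: "'a complex_inner_module" (structure) +
  assumes iprod_add_left:
      "\<lbrakk>x \<in> carrier H; y \<in> carrier H; z \<in> carrier H\<rbrakk>
        \<Longrightarrow> iprod H (x \<oplus> y) z = iprod H x z + iprod H y z"
    and iprod_smult_left:
      "\<lbrakk>x \<in> carrier H; y \<in> carrier H\<rbrakk> \<Longrightarrow> iprod H (a \<odot> x) y = a * iprod H x y"
    and iprod_commute:
      "\<lbrakk>x \<in> carrier H; y \<in> carrier H\<rbrakk> \<Longrightarrow> iprod H x y = cnj (iprod H y x)"
    and iprod_nonneg: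
      "x \<in> carrier H \<Longrightarrow> iprod H x x \<in> \<real>\<^sub>\<ge>\<^sub>0"
    and iprod_eq_0_imp:
      "\<lbrakk>x \<in> carrier H; iprod H x x = 0\<rbrakk> \<Longrightarrow> x = \<zero>"
begin

lemma smult_in_carrier: "x \<in> carrier H \<Longrightarrow> (a::complex) \<odot> x \<in> carrier H"
  by (rule smult_closed) (simp add: ring_of_type_algebra_def)

lemma iprod_add_right:
  "\<lbrakk>x \<in> carrier H; y \<in> carrier H; z \<in> carrier H\<rbrakk>
    \<Longrightarrow> iprod H z (x \<oplus> y) = iprod H z x + iprod H z y"
  by (metis iprod_commute iprod_add_left complex_cnj_add M.a_closed)

lemma iprod_smult_right:
  "\<lbrakk>x \<in> carrier H; y \<in> carrier H\<rbrakk> \<Longrightarrow> iprod H y (a \<odot> x) = cnj a * iprod H y x"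
  by (metis iprod_commute iprod_smult_left complex_cnj_mult smult_in_carrier)

lemma iprod_self_of_real:
  assumes "x \<in> carrier H"
  shows "iprod H x x = complex_of_real ((hnorm H x)\<^sup>2)"
  using iprod_nonneg[OF assms] by (auto simp: hnorm_def nonneg_Reals_def simp flip: of_real_power)

lemma hnorm_nonneg: "x \<in> carrier H \<Longrightarrow> 0 \<le> hnorm H x"
  using iprod_nonneg[of x] by (auto simp: hnorm_def nonneg_Reals_def)

lemma hnorm_eq_0_iff:
  assumes "x \<in> carrier H"
  shows "hnorm H x = 0 \<longleftrightarrow> x = \<zero>"
proof
  assume "hnorm H x = 0"
  then show "x = \<zero>"
    using iprod_self_of_real[OF assms] iprod_eq_0_imp[OF assms] by simp
next
  assume "x = \<zero>"
  moreover have "iprod H \<zero> \<zero> = 0"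
    using iprod_add_left[of \<zero> \<zero> \<zero>] by simp
  ultimately show "hnorm H x = 0"
    by (simp add: hnorm_def)
qed

lemma hnorm_add_le:
  assumes x: "x \<in> carrier H" and y: "y \<in> carrier H"
  shows "hnorm H (x \<oplus> y) \<le> hnorm H x + hnorm H y"
proof -
  define c where "c = iprod H x y"
  have yx: "iprod H y x = cnj c"
    unfolding c_def by (rule iprod_commute[OF y x])
  have sq: "(hnorm H (x \<oplus> a \<odot> y))\<^sup>2
      = (hnorm H x)\<^sup>2 + 2 * Re (cnj a * c) + (cmod a)\<^sup>2 * (hnorm H y)\<^sup>2" for a
  proof -
    have ay: "a \<odot> y \<in> carrier H"
      by (rule smult_in_carrier[OF y])
    have "complex_of_real ((hnorm H (x \<oplus> a \<odot> y))\<^sup>2) =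
        iprod H (x \<oplus> a \<odot> y) (x \<oplus> a \<odot> y)"
      using x ay by (simp only: iprod_self_of_real M.a_closed)
    also have "\<dots> = iprod H x x + (cnj a * c + a * cnj c) + a * cnj a * iprod H y y"
      using x y ay by (simp add: iprod_add_left iprod_add_right iprod_smult_left iprod_smult_right
          c_def[symmetric] yx algebra_simps)
    also have "cnj a * c + a * cnj c = complex_of_real (2 * Re (cnj a * c))"
      using complex_add_cnj[of "cnj a * c"] by simp
    also have "a * cnj a = complex_of_real ((cmod a)\<^sup>2)"
      by (metis complex_norm_square)
    finally have "complex_of_real ((hnorm H (x \<oplus> a \<odot> y))\<^sup>2) = complex_of_real
        ((hnorm H x)\<^sup>2 + 2 * Re (cnj a * c) + (cmod a)\<^sup>2 * (hnorm H y)\<^sup>2)"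
      by (simp only: iprod_self_of_real[OF x] iprod_self_of_real[OF y] of_real_add of_real_mult)
    then show ?thesis
      by (simp only: of_real_eq_iff)
  qed
  have one: "1 \<odot> y = y"
    using smult_one[OF y] by (simp add: ring_of_type_algebra_def)
  have cs: "cmod c \<le> hnorm H x * hnorm H y"
  proof (cases "y = \<zero>")
    case True
    have "iprod H x \<zero> = 0"
      using iprod_add_right[of \<zero> \<zero> x] x by simp
    then show ?thesis
      using True hnorm_eq_0_iff[OF y] by (simp add: c_def)
  next
    case False
    define n where "n = (hnorm H y)\<^sup>2"
    have n: "n > 0"
      using False hnorm_eq_0_iff[OF y] by (simp add: n_def)
    have cc: "cnj c * c = complex_of_real ((cmod c)\<^sup>2)"
      by (metis complex_norm_square mult.commute)
    have "0 \<le> (hnorm H (x \<oplus> (- c / complex_of_real n) \<odot> y))\<^sup>2"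
      by simp
    also have "\<dots> = (hnorm H x)\<^sup>2 + 2 * Re (- (cnj c * c) / complex_of_real n)
        + (cmod c)\<^sup>2 / n\<^sup>2 * n"
      unfolding sq n_def[symmetric] using n by (simp add: norm_divide power_divide)
    also have "Re (- (cnj c * c) / complex_of_real n) = - (cmod c)\<^sup>2 / n"
      unfolding cc by (simp flip: of_real_minus of_real_divide of_real_power)
    also have "(hnorm H x)\<^sup>2 + 2 * (- (cmod c)\<^sup>2 / n) + (cmod c)\<^sup>2 / n\<^sup>2 * n
        = (hnorm H x)\<^sup>2 - (cmod c)\<^sup>2 / n"
      using n by (simp add: field_simps power2_eq_square)
    finally have "(cmod c)\<^sup>2 \<le> (hnorm H x * hnorm H y)\<^sup>2"
      using n by (simp add: field_simps power_mult_distrib n_def)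
    then show ?thesis
      using hnorm_nonneg[OF x] hnorm_nonneg[OF y] by (metis mult_nonneg_nonneg power2_le_imp_le)
  qed
  have "(hnorm H (x \<oplus> y))\<^sup>2 = (hnorm H x)\<^sup>2 + 2 * Re c + (hnorm H y)\<^sup>2"
    using sq[of 1] by (simp add: one)
  also have "\<dots> \<le> (hnorm H x + hnorm H y)\<^sup>2"
    using cs complex_Re_le_cmod[of c] by (simp add: power2_sum)
  finally show ?thesis
    using hnorm_nonneg[OF x] hnorm_nonneg[OF y] by (meson add_nonneg_nonneg power2_le_imp_le)
qed

lemma hnorm_uminus:
  assumes x: "x \<in> carrier H"
  shows "hnorm H (\<ominus> x) = hnorm H x"
proof -
  have nx: "\<ominus> x \<in> carrier H"
    using x by simp
  have *: "iprod H (\<ominus> x) z = - iprod H x z" if z: "z \<in> carrier H" for z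
  proof -
    have "iprod H \<zero> z = 0"
      using iprod_add_left[of \<zero> \<zero> z] z by simp
    then show ?thesis
      using iprod_add_left[OF nx x z] x M.l_neg by (simp add: add_eq_0_iff)
  qed
  have "iprod H x (\<ominus> x) = - iprod H x x"
    using * x nx iprod_commute by (metis complex_cnj_minus)
  then show ?thesis
    using *[OF nx] by (simp add: hnorm_def)
qed

lemma Metric_space_hdist: "Metric_space (carrier H) (hdist H)"
proof
  show "0 \<le> hdist H x y" for x y
    by (simp add: hdist_def hnorm_nonneg)
  show "hdist H x y = hdist H y x" for x y
  proof (cases "x \<in> carrier H \<and> y \<in> carrier H")
    case True
    then have "\<ominus> (x \<ominus> y) = y \<ominus> x"
      by (simp add: M.minus_add M.minus_minus M.a_comm a_minus_def)
    then show ?thesis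
      using True hnorm_uminus[of "x \<ominus> y"] by (simp add: hdist_def)
  qed (auto simp: hdist_def)
  show "hdist H x y = 0 \<longleftrightarrow> x = y" if "x \<in> carrier H" "y \<in> carrier H" for x y
    using that by (simp add: hdist_def hnorm_eq_0_iff)
      (metis M.minus_equality M.minus_minus M.a_inv_closed M.r_neg a_minus_def)
  show "hdist H x z \<le> hdist H x y + hdist H y z"
    if xyz: "x \<in> carrier H" "y \<in> carrier H" "z \<in> carrier H" for x y z
  proof -
    have "(x \<ominus> y) \<oplus> (y \<ominus> z) = x \<ominus> z"
      using xyz by (simp add: a_minus_def M.a_assoc M.r_neg1 M.r_neg2)
    then show ?thesis
      using hnorm_add_le[of "x \<ominus> y" "y \<ominus> z"] xyz by (simp add: hdist_def)
  qed
qed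

end

locale complex_hilbert_space = complex_inner_space +
  assumes complete: "Metric_space.mcomplete (carrier H) (hdist H)"

text \<open>
  Operators are extensional functions (equal to \<^term>\<open>undefined\<close> off the carrier), so that equality
  of operators is equality of HOL functions and the descriptions \<open>THE\<close> below are unambiguous.
  Composition of operators is therefore \<^const>\<open>compose\<close>.
\<close>

definition bounded_ops :: "'a complex_inner_module \<Rightarrow> ('a \<Rightarrow> 'a) set" where
  "bounded_ops H = {T \<in> carrier H \<rightarrow>\<^sub>E carrier H.
     (\<forall>x\<in>carrier H. \<forall>y\<in>carrier H. T (x \<oplus>\<^bsub>H\<^esub> y) = T x \<oplus>\<^bsub>H\<^esub> T y) \<and>
     (\<forall>a. \<forall>x\<in>carrier H. T (a \<odot>\<^bsub>H\<^esub> x) = a \<odot>\<^bsub>H\<^esub> T x) \<and>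
     (\<exists>K. \<forall>x\<in>carrier H. hnorm H (T x) \<le> K * hnorm H x)}"

definition op_norm :: "'a complex_inner_module \<Rightarrow> ('a \<Rightarrow> 'a) \<Rightarrow> real" where
  "op_norm H T = (SUP x\<in>{x \<in> carrier H. hnorm H x \<le> 1}. hnorm H (T x))"

definition op_id :: "'a complex_inner_module \<Rightarrow> 'a \<Rightarrow> 'a" where
  "op_id H = (\<lambda>x\<in>carrier H. x)"

definition op_diff :: "'a complex_inner_module \<Rightarrow> ('a \<Rightarrow> 'a) \<Rightarrow> ('a \<Rightarrow> 'a) \<Rightarrow> 'a \<Rightarrow> 'a" where
  "op_diff H S T = (\<lambda>x\<in>carrier H. S x \<ominus>\<^bsub>H\<^esub> T x)"

definition op_scale :: "'a complex_inner_module \<Rightarrow> complex \<Rightarrow> ('a \<Rightarrow> 'a) \<Rightarrow> 'a \<Rightarrow> 'a" where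
  "op_scale H a T = (\<lambda>x\<in>carrier H. a \<odot>\<^bsub>H\<^esub> T x)"

definition op_ker :: "'a complex_inner_module \<Rightarrow> ('a \<Rightarrow> 'a) \<Rightarrow> 'a set" where
  "op_ker H T = {x \<in> carrier H. T x = \<zero>\<^bsub>H\<^esub>}"

definition op_invertible :: "'a complex_inner_module \<Rightarrow> ('a \<Rightarrow> 'a) \<Rightarrow> bool" where
  "op_invertible H T \<longleftrightarrow> T \<in> bounded_ops H \<and>
     (\<exists>S\<in>bounded_ops H. compose (carrier H) S T = op_id H \<and> compose (carrier H) T S = op_id H)"

definition op_spectrum :: "'a complex_inner_module \<Rightarrow> ('a \<Rightarrow> 'a) \<Rightarrow> complex set" where
  "op_spectrum H T = {z. \<not> op_invertible H (op_diff H T (op_scale H z (op_id H)))}"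

definition hyperbolic :: "'a complex_inner_module \<Rightarrow> ('a \<Rightarrow> 'a) \<Rightarrow> bool" where
  "hyperbolic H T \<longleftrightarrow> op_invertible H T \<and> op_spectrum H T \<inter> {z. cmod z = 1} = {}"

definition op_adjoint :: "'a complex_inner_module \<Rightarrow> ('a \<Rightarrow> 'a) \<Rightarrow> 'a \<Rightarrow> 'a" where
  "op_adjoint H T = (THE S. S \<in> bounded_ops H \<and>
     (\<forall>x\<in>carrier H. \<forall>y\<in>carrier H. iprod H (T x) y = iprod H x (S y)))"

definition positive_op :: "'a complex_inner_module \<Rightarrow> ('a \<Rightarrow> 'a) \<Rightarrow> bool" where
  "positive_op H P \<longleftrightarrow> P \<in> bounded_ops H \<and> (\<forall>x\<in>carrier H. iprod H (P x) x \<in> \<real>\<^sub>\<ge>\<^sub>0)"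

text \<open>The unique positive square root of a positive operator.\<close>

definition op_sqrt :: "'a complex_inner_module \<Rightarrow> ('a \<Rightarrow> 'a) \<Rightarrow> 'a \<Rightarrow> 'a" where
  "op_sqrt H P = (THE S. positive_op H S \<and> compose (carrier H) S S = P)"

definition op_abs :: "'a complex_inner_module \<Rightarrow> ('a \<Rightarrow> 'a) \<Rightarrow> 'a \<Rightarrow> 'a" where
  "op_abs H T = op_sqrt H (compose (carrier H) (op_adjoint H T) T)"

text \<open>Isometric on the orthogonal complement of its kernel.\<close>

definition partial_isometry :: "'a complex_inner_module \<Rightarrow> ('a \<Rightarrow> 'a) \<Rightarrow> bool" where
  "partial_isometry H U \<longleftrightarrow> U \<in> bounded_ops H \<and>
     (\<forall>x\<in>carrier H. (\<forall>y\<in>op_ker H U. iprod H x y = 0) \<longrightarrow> hnorm H (U x) = hnorm H x)"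

definition polar_factor :: "'a complex_inner_module \<Rightarrow> ('a \<Rightarrow> 'a) \<Rightarrow> 'a \<Rightarrow> 'a" where
  "polar_factor H T = (THE U. partial_isometry H U \<and> T = compose (carrier H) U (op_abs H T) \<and>
     op_ker H U = op_ker H T \<and> op_ker H T = op_ker H (op_abs H T))"

definition aluthge :: "'a complex_inner_module \<Rightarrow> ('a \<Rightarrow> 'a) \<Rightarrow> 'a \<Rightarrow> 'a" where
  "aluthge H T = (let R = op_sqrt H (op_abs H T) in
     compose (carrier H) R (compose (carrier H) (polar_factor H T) R))"

definition norm_convergent :: "'a complex_inner_module \<Rightarrow> (nat \<Rightarrow> 'a \<Rightarrow> 'a) \<Rightarrow> bool" where
  "norm_convergent H A \<longleftrightarrow>
     (\<exists>L\<in>bounded_ops H. (\<lambda>n. op_norm H (op_diff H (A n) L)) \<longlonglongrightarrow> 0)"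

end

theory Submission
  imports Defs
begin

text \<open>
  A weighted permutation \<open>(T x) i = a\<^sub>i x (s i)\<close> on \<open>\<ell>\<^sup>2\<close> with positive weights has diagonal modulus, and
  its Aluthge transform is again a weighted permutation along \<open>s\<close>, with weights
  \<open>\<surd>(a (s\<^sup>-\<^sup>1 i) a i)\<close>. Let \<open>s\<close> be the bilateral shift, with weight 4 on one half of its orbit and 2 on
  the other. All weights of all iterates lie in \<open>[2, 4]\<close>, so \<open>T\<close> expands norms by at least 2 and is
  hyperbolic. If the iterates converged in norm, their weights would converge uniformly to some \<open>u\<close>
  with \<open>(u i)\<^sup>2 = u (s\<^sup>-\<^sup>1 i) u i\<close>, hence to a constant. But every iterate still has the weight 4
  near one end of the orbit and the weight 2 near the other.
\<close>

subsection \<open>Bounded operators on complex inner product spaces\<close>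

context complex_inner_space
begin

lemma hnorm_smult:
  assumes x: "x \<in> carrier H"
  shows "hnorm H (a \<odot> x) = cmod a * hnorm H x"
proof -
  have "complex_of_real ((hnorm H (a \<odot> x))\<^sup>2) = iprod H (a \<odot> x) (a \<odot> x)"
    by (simp only: iprod_self_of_real[OF smult_in_carrier[OF x]])
  also have "\<dots> = a * cnj a * iprod H x x"
    using x by (simp add: iprod_smult_left iprod_smult_right smult_in_carrier mult.assoc)
  also have "\<dots> = complex_of_real ((cmod a * hnorm H x)\<^sup>2)"
    by (simp add: iprod_self_of_real[OF x] power_mult_distrib flip: complex_norm_square)
  finally have "(hnorm H (a \<odot> x))\<^sup>2 = (cmod a * hnorm H x)\<^sup>2"
    by (simp only: of_real_eq_iff)
  then show ?thesis
    by (rule power2_eq_imp_eq) (simp_all add: x hnorm_nonneg smult_in_carrier)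
qed

text \<open>Turns negation into a scalar multiple, so that homogeneity of an operator also handles
  negation and, with additivity, differences.\<close>

lemma minus_eq_smult:
  assumes "x \<in> carrier H"
  shows "\<ominus> x = (-1) \<odot> x"
proof (rule M.minus_equality)
  have "(-1) \<odot> x \<oplus> 1 \<odot> x = (-1 + 1) \<odot> x"
    using smult_l_distr[of "-1" 1 x] assms by (simp add: ring_of_type_algebra_def)
  also have "\<dots> = \<zero>"
    using smult_l_null[OF assms] by (simp add: ring_of_type_algebra_def)
  finally show "(-1) \<odot> x \<oplus> x = \<zero>"
    using smult_one[OF assms] by (simp add: ring_of_type_algebra_def)
qed (use assms smult_in_carrier in auto)

lemma eq_if_diff_eq_zero:
  assumes "x \<in> carrier H" "y \<in> carrier H" "x \<ominus> y = \<zero>"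
  shows "x = y"
  using assms M.minus_equality[of x "\<ominus> y"] by (simp add: a_minus_def)

lemma hnorm_diff_ge:
  assumes "x \<in> carrier H" "y \<in> carrier H"
  shows "hnorm H x - hnorm H y \<le> hnorm H (x \<ominus> y)"
proof -
  have "x \<ominus> y \<oplus> y = x"
    using assms by (simp add: a_minus_def M.a_assoc M.l_neg)
  then show ?thesis
    using hnorm_add_le[of "x \<ominus> y" y] assms by simp
qed

lemma bounded_ops_D:
  assumes "T \<in> bounded_ops H"
  shows "x \<in> carrier H \<Longrightarrow> T x \<in> carrier H"
    and "x \<in> carrier H \<Longrightarrow> y \<in> carrier H \<Longrightarrow> T (x \<oplus> y) = T x \<oplus> T y"
    and "x \<in> carrier H \<Longrightarrow> T (a \<odot> x) = a \<odot> T x"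
    and "\<exists>K. \<forall>x\<in>carrier H. hnorm H (T x) \<le> K * hnorm H x"
    and "T \<in> extensional (carrier H)"
  using assms unfolding bounded_ops_def by (auto simp: PiE_def)

lemma bounded_ops_diff:
  assumes T: "T \<in> bounded_ops H" and x: "x \<in> carrier H" and y: "y \<in> carrier H"
  shows "T (x \<ominus> y) = T x \<ominus> T y"
  using x y by (simp add: a_minus_def bounded_ops_D[OF T] minus_eq_smult smult_in_carrier)

lemma hnorm_le_op_norm:
  assumes T: "T \<in> bounded_ops H" and x: "x \<in> carrier H" "hnorm H x \<le> 1"
  shows "hnorm H (T x) \<le> op_norm H T"
proof -
  obtain K where K: "\<And>x. x \<in> carrier H \<Longrightarrow> hnorm H (T x) \<le> K * hnorm H x"
    using bounded_ops_D(4)[OF T] by blast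
  \<comment> \<open>On the zero space any \<open>K\<close>, even a negative one, is admissible; the
    absolute value is a bound in every case.\<close>
  have "hnorm H (T y) \<le> \<bar>K\<bar>" if y: "y \<in> carrier H" "hnorm H y \<le> 1" for y
  proof -
    have "hnorm H (T y) \<le> \<bar>K\<bar> * hnorm H y"
      using K[OF y(1)] mult_right_mono[OF abs_ge_self[of K] hnorm_nonneg[OF y(1)]] by linarith
    also have "\<dots> \<le> \<bar>K\<bar>"
      using y by (simp add: mult_left_le)
    finally show ?thesis .
  qed
  then show ?thesis
    unfolding op_norm_def using x by (intro cSUP_upper bdd_aboveI2) auto
qed

lemma op_diff_bounded:
  assumes S: "S \<in> bounded_ops H" and T: "T \<in> bounded_ops H"
  shows "op_diff H S T \<in> bounded_ops H"
proof -
  note [simp] = bounded_ops_D(1-3)[OF S] bounded_ops_D(1-3)[OF T]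
  obtain K L where K: "\<And>x. x \<in> carrier H \<Longrightarrow> hnorm H (S x) \<le> K * hnorm H x"
    and L: "\<And>x. x \<in> carrier H \<Longrightarrow> hnorm H (T x) \<le> L * hnorm H x"
    using bounded_ops_D(4)[OF S] bounded_ops_D(4)[OF T] by blast
  have "hnorm H (S x \<ominus> T x) \<le> (K + L) * hnorm H x" if x: "x \<in> carrier H" for x
    using hnorm_add_le[of "S x" "\<ominus> T x"] hnorm_uminus[of "T x"] K[OF x] L[OF x] x
    by (simp add: a_minus_def distrib_right)
  moreover have "S x \<oplus> S y \<ominus> (T x \<oplus> T y) = (S x \<ominus> T x) \<oplus> (S y \<ominus> T y)"
    if "x \<in> carrier H" "y \<in> carrier H" for x y
    using that by (simp add: a_minus_def M.minus_add M.a_ac)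
  moreover have "a \<odot> S x \<ominus> a \<odot> T x = a \<odot> (S x \<ominus> T x)" if "x \<in> carrier H" for a x
    using that smult_r_distr[of a "S x" "\<ominus> T x"] smult_r_minus[of a "T x"]
    by (simp add: a_minus_def ring_of_type_algebra_def)
  ultimately show ?thesis
    unfolding bounded_ops_def op_diff_def by (auto simp: smult_in_carrier)
qed

lemma op_scale_id_bounded: "op_scale H z (op_id H) \<in> bounded_ops H"
proof -
  have "a \<odot> (b \<odot> x) = b \<odot> (a \<odot> x)" if "x \<in> carrier H" for a b x
    using that smult_assoc1[of a b x] smult_assoc1[of b a x]
    by (simp add: ring_of_type_algebra_def mult.commute)
  moreover have "z \<odot> (x \<oplus> y) = z \<odot> x \<oplus> z \<odot> y" if "x \<in> carrier H" "y \<in> carrier H" for x y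
    using that smult_r_distr[of z x y] by (simp add: ring_of_type_algebra_def)
  ultimately show ?thesis
    unfolding bounded_ops_def op_scale_def op_id_def
    by (auto simp: smult_in_carrier hnorm_smult)
qed

text \<open>The lower bound serves twice: it makes \<open>A\<close> injective, and it bounds the
  set-theoretic inverse by \<open>1 / k\<close>. Linearity of the inverse follows by applying it to
  \<open>A\<close> of a sum or a multiple of preimages.\<close>

lemma op_invertible_if_bounded_below:
  assumes A: "A \<in> bounded_ops H" and k: "k > 0"
    and below: "\<And>x. x \<in> carrier H \<Longrightarrow> k * hnorm H x \<le> hnorm H (A x)"
    and surj: "\<And>y. y \<in> carrier H \<Longrightarrow> \<exists>x\<in>carrier H. A x = y"
  shows "op_invertible H A"
proof -
  note [simp] = bounded_ops_D(1-3)[OF A]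
  have inj: "inj_on A (carrier H)"
  proof (rule inj_onI)
    fix x y assume xy: "x \<in> carrier H" "y \<in> carrier H" "A x = A y"
    then have "A (x \<ominus> y) = \<zero>"
      by (simp only: bounded_ops_diff[OF A]) (simp add: M.r_neg a_minus_def)
    moreover have "hnorm H \<zero> = 0"
      by (simp add: hnorm_eq_0_iff)
    ultimately have "hnorm H (x \<ominus> y) = 0"
      using below[of "x \<ominus> y"] hnorm_nonneg[of "x \<ominus> y"] k xy by (simp add: mult_le_0_iff)
    then show "x = y"
      using xy by (simp add: hnorm_eq_0_iff eq_if_diff_eq_zero)
  qed
  define B where "B = (\<lambda>y\<in>carrier H. inv_into (carrier H) A y)"
  have img: "A ` carrier H = carrier H"
    using surj by (force simp: image_iff)
  have B: "B y \<in> carrier H" "A (B y) = y" if "y \<in> carrier H" for y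
    using that img inv_into_into[of y A "carrier H"] f_inv_into_f[of y A "carrier H"]
    by (simp_all add: B_def)
  have BA: "B (A x) = x" if "x \<in> carrier H" for x
    using that inj by (simp add: B_def)
  have "B \<in> bounded_ops H"
    unfolding bounded_ops_def mem_Collect_eq
  proof (intro conjI ballI allI exI[of _ "1 / k"])
    show "B \<in> carrier H \<rightarrow>\<^sub>E carrier H"
      using B by (simp add: B_def PiE_def)
    show "B (x \<oplus> y) = B x \<oplus> B y" if "x \<in> carrier H" "y \<in> carrier H" for x y
      using BA[of "B x \<oplus> B y"] that by (simp add: B)
    show "B (a \<odot> x) = a \<odot> B x" if "x \<in> carrier H" for x a
      using BA[of "a \<odot> B x"] that by (simp add: B smult_in_carrier)
    show "hnorm H (B x) \<le> 1 / k * hnorm H x" if "x \<in> carrier H" for x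
      using below[of "B x"] that k by (simp add: B field_simps)
  qed
  moreover have "compose (carrier H) B A = op_id H" "compose (carrier H) A B = op_id H"
    by (auto simp: compose_def op_id_def fun_eq_iff B BA)
  ultimately show ?thesis
    using A unfolding op_invertible_def by blast
qed

text \<open>Polarization: over the complex numbers a real-valued quadratic form already forces
  symmetry, which \<open>positive_op\<close> does not list as a condition.\<close>

lemma positive_op_symmetric:
  assumes S: "positive_op H S" and x: "x \<in> carrier H" and y: "y \<in> carrier H"
  shows "iprod H (S x) y = iprod H x (S y)"
proof -
  have Sb: "S \<in> bounded_ops H"
    using S by (simp add: positive_op_def)
  note [simp] = bounded_ops_D(1-3)[OF Sb] x y
  have real: "Im (iprod H (S v) v) = 0" if "v \<in> carrier H" for v
    using S that by (auto simp: positive_op_def nonneg_Reals_def)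
  \<comment> \<open>In the form at \<open>x \<oplus> a \<odot> y\<close> the diagonal terms are
    real, so the two cross terms together are real as well.\<close>
  have cross: "Im (cnj a * iprod H (S x) y + a * iprod H (S y) x) = 0" for a
    using real[of "x \<oplus> a \<odot> y"] real[OF x] real[OF y]
    by (simp add: iprod_add_left iprod_add_right iprod_smult_left iprod_smult_right smult_in_carrier
        algebra_simps)
  \<comment> \<open>The choice \<open>a = 1\<close> compares imaginary parts,
    \<open>a = \<i>\<close> compares real parts.\<close>
  have "iprod H (S x) y = cnj (iprod H (S y) x)"
    using cross[of 1] cross[of \<i>] by (simp add: complex_eq_iff)
  also have "\<dots> = iprod H x (S y)"
    by (rule iprod_commute[symmetric]) simp_all
  finally show ?thesis .
qed

end

section \<open>Hyperbolicity of expanding invertible operators\<close>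

context complex_hilbert_space
begin

text \<open>For \<open>z\<close> on the unit circle the reverse triangle inequality bounds
  \<open>T - z\<close> below by \<open>k - 1\<close>. Surjectivity of \<open>T - z\<close> comes
  from Banach's fixed point theorem, and this is where completeness enters.\<close>

lemma hyperbolic_if_expanding:
  assumes T: "op_invertible H T" and k: "k > 1"
    and below: "\<And>x. x \<in> carrier H \<Longrightarrow> k * hnorm H x \<le> hnorm H (T x)"
  shows "hyperbolic H T"
proof -
  interpret Metric_space "carrier H" "hdist H"
    by (rule Metric_space_hdist)
  have Tb: "T \<in> bounded_ops H"
    using T by (simp add: op_invertible_def)
  note [simp] = bounded_ops_D(1)[OF Tb] smult_in_carrier
  obtain S where S: "S \<in> bounded_ops H" and TS: "compose (carrier H) T S = op_id H"
    using T unfolding op_invertible_def by blast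
  note [simp] = bounded_ops_D(1)[OF S]
  have TS: "T (S y) = y" if "y \<in> carrier H" for y
    using fun_cong[OF TS, of y] that by (simp add: compose_def op_id_def)
  have "op_invertible H (op_diff H T (op_scale H z (op_id H)))" if z: "cmod z = 1" for z
  proof (rule op_invertible_if_bounded_below)
    have eval: "op_diff H T (op_scale H z (op_id H)) x = T x \<ominus> z \<odot> x" if "x \<in> carrier H" for x
      using that by (simp add: op_diff_def op_scale_def op_id_def)
    show "op_diff H T (op_scale H z (op_id H)) \<in> bounded_ops H"
      by (intro op_diff_bounded Tb op_scale_id_bounded)
    show "k - 1 > 0"
      using k by simp
    show "(k - 1) * hnorm H x \<le> hnorm H (op_diff H T (op_scale H z (op_id H)) x)"
      if x: "x \<in> carrier H" for x
      using hnorm_diff_ge[of "T x" "z \<odot> x"] below[OF x] z x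
      by (simp add: eval hnorm_smult left_diff_distrib)
    show "\<exists>x\<in>carrier H. op_diff H T (op_scale H z (op_id H)) x = y" if y: "y \<in> carrier H" for y
    proof -
      \<comment> \<open>Solving \<open>T x - z x = y\<close> amounts to finding a fixed point of
        \<open>f\<close>. It contracts by \<open>1 / k\<close>, because \<open>T\<close> maps
        \<open>f u - f v\<close> to \<open>z (u - v)\<close>, a vector of norm
        \<open>hdist H u v\<close>, and expands norms by at least \<open>k\<close>.\<close>
      define f where "f x = S (y \<oplus> z \<odot> x)" for x
      have f_carrier: "f x \<in> carrier H" if "x \<in> carrier H" for x
        using that y by (simp add: f_def)
      have contr: "hdist H (f u) (f v) \<le> 1 / k * hdist H u v" if uv: "u \<in> carrier H" "v \<in> carrier H" for u v
      proof -
        have "T (f u \<ominus> f v) = (y \<oplus> z \<odot> u) \<ominus> (y \<oplus> z \<odot> v)"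
          using uv y f_carrier by (simp add: bounded_ops_diff[OF Tb]) (simp add: f_def TS)
        also have "\<dots> = z \<odot> u \<ominus> z \<odot> v"
          using uv y by (simp add: a_minus_def M.minus_add M.a_ac M.r_neg1 M.r_neg2)
        \<comment> \<open>Read off from the linearity of the operator that scales by
          \<open>z\<close>.\<close>
        also have "\<dots> = z \<odot> (u \<ominus> v)"
          using bounded_ops_diff[OF op_scale_id_bounded[of z], of u v] uv
          by (simp add: op_scale_def op_id_def)
        finally show ?thesis
          using below[of "f u \<ominus> f v"] k uv f_carrier z by (simp add: hdist_def hnorm_smult field_simps)
      qed
      obtain x where x: "x \<in> carrier H" "f x = x"
        using Banach_fixedpoint_thm[OF complete _ _ _ contr] k f_carrier by auto
      then have "T x = y \<oplus> z \<odot> x"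
        using y TS[of "y \<oplus> z \<odot> x"] by (simp add: f_def)
      then have "T x \<ominus> z \<odot> x = y"
        using y x by (simp add: a_minus_def M.a_assoc M.r_neg)
      with x show ?thesis
        by (auto simp: eval)
    qed
  qed
  then show ?thesis
    using T by (auto simp: hyperbolic_def op_spectrum_def)
qed

end

subsection \<open>The Hilbert space of square-summable families\<close>

text \<open>Summation is unordered, so the index type can stay arbitrary and a bijective reindexing
  changes neither membership nor the norm.\<close>

definition ell2 :: "('i \<Rightarrow> complex) complex_inner_module" where
  "ell2 = \<lparr>carrier = {x. (\<lambda>i. (cmod (x i))\<^sup>2) summable_on UNIV},
     monoid.mult = (\<lambda>x y i. x i * y i), one = (\<lambda>i. 1),
     zero = (\<lambda>i. 0), add = (\<lambda>x y i. x i + y i), smult = (\<lambda>a x i. a * x i),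
     iprod = (\<lambda>x y. \<Sum>\<^sub>\<infinity>i. x i * cnj (y i))\<rparr>"

lemma ell2_zero [simp]: "\<zero>\<^bsub>ell2\<^esub> = (\<lambda>i. 0)"
  and ell2_add [simp]: "x \<oplus>\<^bsub>ell2\<^esub> y = (\<lambda>i. x i + y i)"
  and ell2_smult [simp]: "a \<odot>\<^bsub>ell2\<^esub> x = (\<lambda>i. a * x i)"
  and ell2_iprod: "iprod ell2 x y = (\<Sum>\<^sub>\<infinity>i. x i * cnj (y i))"
  and ell2_carrier: "x \<in> carrier ell2 \<longleftrightarrow> (\<lambda>i. (cmod (x i))\<^sup>2) summable_on UNIV"
  by (simp_all add: ell2_def)

lemma ell2_zero_carrier: "(\<lambda>i. 0) \<in> carrier ell2"
  by (simp add: ell2_carrier)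

lemma ell2_hnorm_zero: "hnorm ell2 (\<lambda>i. 0) = 0"
  by (simp add: hnorm_def ell2_iprod)

text \<open>Uniform bounds on finite partial sums are the working criterion: they survive
  coordinatewise limits and pointwise domination.\<close>

lemma ell2_I:
  assumes "\<And>F. finite F \<Longrightarrow> (\<Sum>i\<in>F. (cmod (x i))\<^sup>2) \<le> B"
  shows "x \<in> carrier ell2"
  unfolding ell2_carrier
proof (rule nonneg_bdd_above_summable_on)
  show "bdd_above (sum (\<lambda>i. (cmod (x i))\<^sup>2) ` {F. F \<subseteq> UNIV \<and> finite F})"
    using assms by (intro bdd_aboveI2[of _ _ B]) simp
qed simp

lemma ell2_sum_mult_summable:
  assumes "x \<in> carrier ell2" "y \<in> carrier ell2"
  shows "(\<lambda>i. x i * cnj (y i)) summable_on UNIV"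
proof (rule abs_summable_summable, rule abs_summable_product)
  show "(\<lambda>i. cmod (x i * x i)) summable_on UNIV" "(\<lambda>i. cmod (cnj (y i) * cnj (y i))) summable_on UNIV"
    using assms by (simp_all add: ell2_carrier norm_mult power2_eq_square)
qed

lemma ell2_add_closed:
  assumes "x \<in> carrier ell2" "y \<in> carrier ell2"
  shows "(\<lambda>i. x i + y i) \<in> carrier ell2"
proof -
  have "(cmod (x i + y i))\<^sup>2 \<le> 2 * (cmod (x i))\<^sup>2 + 2 * (cmod (y i))\<^sup>2" for i
  proof -
    have "(cmod (x i + y i))\<^sup>2 \<le> (cmod (x i) + cmod (y i))\<^sup>2"
      by (intro power_mono norm_triangle_ineq) auto
    also have "\<dots> \<le> 2 * (cmod (x i))\<^sup>2 + 2 * (cmod (y i))\<^sup>2"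
      using zero_le_power2[of "cmod (x i) - cmod (y i)"] by (simp add: power2_sum power2_diff)
    finally show ?thesis .
  qed
  moreover have "(\<lambda>i. 2 * (cmod (x i))\<^sup>2 + 2 * (cmod (y i))\<^sup>2) summable_on UNIV"
    using assms by (intro summable_on_add summable_on_cmult_right) (simp_all add: ell2_carrier)
  ultimately show ?thesis
    unfolding ell2_carrier by (rule_tac summable_on_comparison_test) simp_all
qed

lemma ell2_smult_closed:
  assumes "x \<in> carrier ell2"
  shows "(\<lambda>i. a * x i) \<in> carrier ell2"
  using assms summable_on_cmult_right[of "\<lambda>i. (cmod (x i))\<^sup>2" UNIV "(cmod a)\<^sup>2"]
  by (simp add: ell2_carrier norm_mult power_mult_distrib)

lemma infsum_complex_of_real:
  "(\<Sum>\<^sub>\<infinity>i\<in>A. complex_of_real (f i)) = complex_of_real (infsum f A)"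
proof (cases "f summable_on A")
  case True
  then show ?thesis
    by (intro infsumI) (simp add: has_sum_of_real_iff)
next
  case False
  \<comment> \<open>Here both sides take the default value 0, since summability of the complex
    family would pass to \<open>f\<close> through the real part.\<close>
  then have "\<not> (\<lambda>i. complex_of_real (f i)) summable_on A"
    using summable_on_bounded_linear[OF bounded_linear_Re, of "\<lambda>i. complex_of_real (f i)" A] by auto
  with False show ?thesis
    by (simp add: infsum_not_exists)
qed

lemma ell2_iprod_self:
  "iprod ell2 x x = complex_of_real (\<Sum>\<^sub>\<infinity>i. (cmod (x i))\<^sup>2)"
  by (simp add: ell2_iprod complex_norm_square[symmetric] infsum_complex_of_real flip: of_real_power)

text \<open>True off the carrier as well: there the infinite sum, and with it the norm, defaults to
  0.\<close>

lemma ell2_hnorm_sq: "(hnorm ell2 x)\<^sup>2 = (\<Sum>\<^sub>\<infinity>i. (cmod (x i))\<^sup>2)"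
  by (simp add: hnorm_def ell2_iprod_self infsum_nonneg)

lemma ell2_hnorm_nonneg: "0 \<le> hnorm ell2 x"
  by (simp add: hnorm_def ell2_iprod_self infsum_nonneg)

lemma ell2_finite_sum_le:
  assumes "x \<in> carrier ell2" "finite F"
  shows "(\<Sum>i\<in>F. (cmod (x i))\<^sup>2) \<le> (hnorm ell2 x)\<^sup>2"
  using assms unfolding ell2_hnorm_sq ell2_carrier by (intro finite_sum_le_infsum) auto

lemma ell2_cmod_le:
  assumes "x \<in> carrier ell2"
  shows "cmod (x i) \<le> hnorm ell2 x"
  using ell2_finite_sum_le[OF assms, of "{i}"] ell2_hnorm_nonneg[of x] by (simp add: power2_le_iff_abs_le)

lemma ell2_hnorm_le:
  assumes "\<And>F. finite F \<Longrightarrow> (\<Sum>i\<in>F. (cmod (x i))\<^sup>2) \<le> B\<^sup>2" and "0 \<le> B"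
  shows "hnorm ell2 x \<le> B"
proof -
  have "(hnorm ell2 x)\<^sup>2 \<le> B\<^sup>2"
    unfolding ell2_hnorm_sq using ell2_I[OF assms(1)] assms(1)
    by (intro infsum_le_finite_sums) (auto simp: ell2_carrier)
  then show ?thesis
    using assms(2) by (rule power2_le_imp_le)
qed

section \<open>Vector space, inner product and completeness axioms for square-summable
  families\<close>

lemma abelian_group_ell2: "abelian_group (ell2 :: ('i \<Rightarrow> complex) complex_inner_module)"
proof (rule abelian_groupI)
  fix x :: "'i \<Rightarrow> complex"
  assume "x \<in> carrier ell2"
  then show "\<exists>y\<in>carrier ell2. y \<oplus>\<^bsub>ell2\<^esub> x = \<zero>\<^bsub>ell2\<^esub>"
    using ell2_smult_closed[of x "-1"] by (intro bexI[of _ "\<lambda>i. - x i"]) auto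
qed (auto simp: add.assoc add.commute ell2_add_closed, simp add: ell2_carrier)

lemma complex_inner_space_ell2: "complex_inner_space (ell2 :: ('i \<Rightarrow> complex) complex_inner_module)"
proof (intro complex_inner_space.intro complex_inner_space_axioms.intro moduleI)
  fix x y z :: "'i \<Rightarrow> complex"
  assume x: "x \<in> carrier ell2" and y: "y \<in> carrier ell2" and z: "z \<in> carrier ell2"
  show "iprod ell2 (x \<oplus>\<^bsub>ell2\<^esub> y) z = iprod ell2 x z + iprod ell2 y z"
    using x y z by (simp add: ell2_iprod distrib_right infsum_add ell2_sum_mult_summable)
next
  fix x y :: "'i \<Rightarrow> complex" and a
  show "iprod ell2 (a \<odot>\<^bsub>ell2\<^esub> x) y = a * iprod ell2 x y"
    by (simp add: ell2_iprod mult.assoc infsum_cmult_right')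
next
  fix x y :: "'i \<Rightarrow> complex"
  show "iprod ell2 x y = cnj (iprod ell2 y x)"
    by (simp add: ell2_iprod mult.commute flip: infsum_cnj)
next
  fix x :: "'i \<Rightarrow> complex"
  show "iprod ell2 x x \<in> \<real>\<^sub>\<ge>\<^sub>0"
    by (simp add: ell2_iprod_self infsum_nonneg)
next
  fix x :: "'i \<Rightarrow> complex"
  assume x: "x \<in> carrier ell2" and "iprod ell2 x x = 0"
  then have "hnorm ell2 x = 0"
    by (simp add: hnorm_def)
  then show "x = \<zero>\<^bsub>ell2\<^esub>"
    using ell2_cmod_le[OF x] by (auto simp: fun_eq_iff)
next
  show "cring (ring_of_type_algebra :: complex ring)"
    by (rule cring_from_type_algebra)
  show "abelian_group (ell2 :: ('i \<Rightarrow> complex) complex_inner_module)"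
    by (rule abelian_group_ell2)
qed (auto simp: ring_of_type_algebra_def algebra_simps ell2_smult_closed)

interpretation ell2: complex_inner_space "ell2 :: ('i \<Rightarrow> complex) complex_inner_module"
  by (rule complex_inner_space_ell2)

lemma ell2_uminus: "x \<in> carrier ell2 \<Longrightarrow> \<ominus>\<^bsub>ell2\<^esub> x = (\<lambda>i. - x i)"
  using ell2_smult_closed[of x "-1"] by (intro ell2.M.minus_equality) auto

lemma ell2_minus: "y \<in> carrier ell2 \<Longrightarrow> x \<ominus>\<^bsub>ell2\<^esub> y = (\<lambda>i. x i - y i)"
  by (simp add: a_minus_def ell2_uminus)

lemma ell2_diff_closed:
  assumes "x \<in> carrier ell2" "y \<in> carrier ell2"
  shows "(\<lambda>i. x i - y i) \<in> carrier ell2"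
  using ell2.M.minus_closed[OF assms] by (simp add: ell2_minus assms)

lemma ell2_hdist:
  assumes "x \<in> carrier ell2" "y \<in> carrier ell2"
  shows "hdist ell2 x y = hnorm ell2 (\<lambda>i. x i - y i)"
  using assms by (simp add: hdist_def ell2_minus)

lemma mcomplete_ell2:
  "Metric_space.mcomplete (carrier (ell2 :: ('i \<Rightarrow> complex) complex_inner_module)) (hdist ell2)"
proof -
  interpret Metric_space "carrier (ell2 :: ('i \<Rightarrow> complex) complex_inner_module)" "hdist ell2"
    by (rule ell2.Metric_space_hdist)
  show ?thesis
    unfolding mcomplete_def
  proof (intro allI impI)
    fix s :: "nat \<Rightarrow> 'i \<Rightarrow> complex"
    assume "MCauchy s"
    then have s: "s n \<in> carrier ell2" for n
      unfolding MCauchy_def by blast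
    have cau: "\<exists>N. \<forall>n m. N \<le> n \<longrightarrow> N \<le> m \<longrightarrow> hdist ell2 (s n) (s m) < e" if "e > 0" for e
      using \<open>MCauchy s\<close> that unfolding MCauchy_def by (elim conjE allE[of _ e] impE)
    \<comment> \<open>Each coordinate is dominated by the norm, so the candidate limit
      \<open>l\<close> can be formed coordinatewise.\<close>
    have "Cauchy (\<lambda>n. s n i)" for i
    proof (rule metric_CauchyI)
      fix e :: real assume "e > 0"
      then obtain N where N: "\<And>n m. n \<ge> N \<Longrightarrow> m \<ge> N \<Longrightarrow> hdist ell2 (s n) (s m) < e"
        using cau by blast
      have "dist (s n i) (s m i) \<le> hdist ell2 (s n) (s m)" for n m
        using ell2_cmod_le[OF ell2_diff_closed[OF s s]] by (simp add: ell2_hdist s dist_norm)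
      then show "\<exists>N. \<forall>m\<ge>N. \<forall>n\<ge>N. dist (s m i) (s n i) < e"
        using N by (meson le_less_trans)
    qed
    then have l: "(\<lambda>n. s n i) \<longlonglongrightarrow> lim (\<lambda>n. s n i)" for i
      by (simp add: Cauchy_convergent flip: convergent_LIMSEQ_iff)
    define l where "l i = lim (\<lambda>n. s n i)" for i
    note l = l[folded l_def]
    have close: "\<exists>N. \<forall>n\<ge>N. (\<lambda>i. s n i - l i) \<in> carrier ell2 \<and> hnorm ell2 (\<lambda>i. s n i - l i) \<le> e"
      if "e > 0" for e
    proof -
      obtain N where N: "\<And>n m. n \<ge> N \<Longrightarrow> m \<ge> N \<Longrightarrow> hdist ell2 (s n) (s m) < e"
        using cau \<open>e > 0\<close> by blast
      \<comment> \<open>The limit in \<open>m\<close> is taken inside a fixed finite sum, where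
        coordinatewise convergence is enough; the bound does not depend on \<open>F\<close>.\<close>
      have le: "(\<Sum>i\<in>F. (cmod (s n i - l i))\<^sup>2) \<le> e\<^sup>2" if "n \<ge> N" "finite F" for n F
      proof (rule tendsto_upperbound)
        show "(\<lambda>m. \<Sum>i\<in>F. (cmod (s n i - s m i))\<^sup>2) \<longlonglongrightarrow> (\<Sum>i\<in>F. (cmod (s n i - l i))\<^sup>2)"
          by (intro tendsto_intros l)
        have "(\<Sum>i\<in>F. (cmod (s n i - s m i))\<^sup>2) \<le> e\<^sup>2" if "m \<ge> N" for m
        proof -
          have "(\<Sum>i\<in>F. (cmod (s n i - s m i))\<^sup>2) \<le> (hdist ell2 (s n) (s m))\<^sup>2"
            using ell2_finite_sum_le[OF ell2_diff_closed[OF s s] \<open>finite F\<close>] by (simp add: ell2_hdist s)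
          also have "\<dots> \<le> e\<^sup>2"
            using N[OF \<open>n \<ge> N\<close> that] by (intro power_mono) auto
          finally show ?thesis .
        qed
        then show "\<forall>\<^sub>F m in sequentially. (\<Sum>i\<in>F. (cmod (s n i - s m i))\<^sup>2) \<le> e\<^sup>2"
          unfolding eventually_sequentially by blast
      qed simp
      then show ?thesis
        using ell2_I[OF le] ell2_hnorm_le[OF le] \<open>e > 0\<close> by (intro exI[of _ N]) simp
    qed
    \<comment> \<open>Membership of \<open>l\<close> comes from writing it as
      \<open>s N - (s N - l)\<close>; the value 1 is arbitrary.\<close>
    obtain N where "(\<lambda>i. s N i - l i) \<in> carrier ell2"
      using close[of 1] by auto
    from ell2_diff_closed[OF s[of N] this] have l2: "l \<in> carrier ell2"
      by simp
    moreover have "\<exists>N. \<forall>n\<ge>N. s n \<in> carrier ell2 \<and> hdist ell2 (s n) l < e" if "e > 0" for e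
    proof -
      obtain N where N: "\<And>n. n \<ge> N \<Longrightarrow> hnorm ell2 (\<lambda>i. s n i - l i) \<le> e / 2"
        using close[of "e / 2"] \<open>e > 0\<close> by auto
      show ?thesis
      proof (intro exI allI impI conjI s)
        show "hdist ell2 (s n) l < e" if "n \<ge> N" for n
          using N[OF that] \<open>e > 0\<close> by (simp add: ell2_hdist s l2)
      qed
    qed
    ultimately show "\<exists>l. limitin mtopology s l sequentially"
      unfolding limit_metric_sequentially by blast
  qed
qed

lemma complex_hilbert_space_ell2: "complex_hilbert_space ell2"
  by (intro complex_hilbert_space.intro complex_inner_space_ell2 complex_hilbert_space_axioms.intro
      mcomplete_ell2)

subsection \<open>Weighted permutation operators\<close>

text \<open>The standard orthonormal basis. Pairing with it reads off coordinates, which is how the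
  uniqueness proofs for adjoint and square root identify operators.\<close>

definition unit_vec :: "'i \<Rightarrow> 'i \<Rightarrow> complex" where
  "unit_vec j = (\<lambda>i. if i = j then 1 else 0)"

lemma unit_vec_carrier: "unit_vec j \<in> carrier ell2"
proof (rule ell2_I)
  show "(\<Sum>i\<in>F. (cmod (unit_vec j i))\<^sup>2) \<le> 1" if "finite F" for F
  proof -
    have "(cmod (unit_vec j i))\<^sup>2 = (if i = j then 1 else 0)" for i
      by (simp add: unit_vec_def)
    with that show ?thesis
      by simp
  qed
qed

lemma iprod_unit_vec: "iprod ell2 x (unit_vec j) = x j"
proof -
  have "iprod ell2 x (unit_vec j) = (\<Sum>\<^sub>\<infinity>i\<in>{j}. x i * cnj (unit_vec j i))"
    unfolding ell2_iprod by (rule infsum_cong_neutral) (auto simp: unit_vec_def)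
  then show ?thesis
    by (simp add: unit_vec_def)
qed

lemma hnorm_unit_vec: "hnorm ell2 (unit_vec j) = 1"
  by (simp add: hnorm_def iprod_unit_vec) (simp add: unit_vec_def)

text \<open>Used in both directions: to bound a weighted permutation above, and, with input and
  output exchanged, to bound it below.\<close>

lemma ell2_hnorm_mult_le:
  assumes "x \<in> carrier ell2" and "\<And>i. cmod (y i) \<le> C * cmod (x i)" and "0 \<le> C"
  shows "y \<in> carrier ell2" and "hnorm ell2 y \<le> C * hnorm ell2 x"
proof -
  have le: "(\<Sum>i\<in>F. (cmod (y i))\<^sup>2) \<le> (C * hnorm ell2 x)\<^sup>2" if "finite F" for F
  proof -
    have "(\<Sum>i\<in>F. (cmod (y i))\<^sup>2) \<le> (\<Sum>i\<in>F. C\<^sup>2 * (cmod (x i))\<^sup>2)"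
      unfolding power_mult_distrib[symmetric] by (intro sum_mono power_mono assms) simp
    also have "\<dots> \<le> C\<^sup>2 * (hnorm ell2 x)\<^sup>2"
      unfolding sum_distrib_left[symmetric]
      by (intro mult_left_mono ell2_finite_sum_le assms that) simp
    finally show ?thesis
      by (simp add: power_mult_distrib)
  qed
  show "y \<in> carrier ell2"
    by (rule ell2_I[OF le])
  show "hnorm ell2 y \<le> C * hnorm ell2 x"
    by (rule ell2_hnorm_le[OF le]) (simp_all add: assms ell2_hnorm_nonneg)
qed

lemma ell2_reindex:
  assumes "bij s"
  shows "(\<lambda>i. x (s i)) \<in> carrier ell2 \<longleftrightarrow> x \<in> carrier ell2"
    and "hnorm ell2 (\<lambda>i. x (s i)) = hnorm ell2 x"
proof -
  show "(\<lambda>i. x (s i)) \<in> carrier ell2 \<longleftrightarrow> x \<in> carrier ell2"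
    unfolding ell2_carrier using assms
    by (rule summable_on_reindex_bij_betw[of s UNIV UNIV "\<lambda>i. (cmod (x i))\<^sup>2"])
  have "(hnorm ell2 (\<lambda>i. x (s i)))\<^sup>2 = (hnorm ell2 x)\<^sup>2"
    unfolding ell2_hnorm_sq using assms
    by (rule infsum_reindex_bij_betw[of s UNIV UNIV "\<lambda>i. (cmod (x i))\<^sup>2"])
  then show "hnorm ell2 (\<lambda>i. x (s i)) = hnorm ell2 x"
    by (rule power2_eq_imp_eq) (simp_all add: ell2_hnorm_nonneg)
qed

text \<open>Coordinates are pulled back along \<open>s\<close>: for bijective \<open>s\<close> the
  operator sends \<open>unit_vec (s i)\<close> to \<open>a i\<close> times
  \<open>unit_vec i\<close>. The restriction to the carrier makes it extensional, as
  \<open>bounded_ops\<close> demands.\<close>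

definition wperm :: "('i \<Rightarrow> real) \<Rightarrow> ('i \<Rightarrow> 'i) \<Rightarrow> ('i \<Rightarrow> complex) \<Rightarrow> 'i \<Rightarrow> complex" where
  "wperm a s = (\<lambda>x\<in>carrier ell2. \<lambda>i. complex_of_real (a i) * x (s i))"

lemma wperm_apply: "x \<in> carrier ell2 \<Longrightarrow> wperm a s x = (\<lambda>i. complex_of_real (a i) * x (s i))"
  by (simp add: wperm_def)

lemma wperm_closed:
  assumes "bij s" "\<And>i. \<bar>a i\<bar> \<le> C" and x: "x \<in> carrier ell2"
  shows "wperm a s x \<in> carrier ell2" and "hnorm ell2 (wperm a s x) \<le> C * hnorm ell2 x"
proof -
  have C: "0 \<le> C"
    using assms(2) abs_ge_zero order_trans by blast
  have le: "cmod (wperm a s x i) \<le> C * cmod (x (s i))" for i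
    using mult_right_mono[OF assms(2)[of i], of "cmod (x (s i))"]
    by (simp add: wperm_apply[OF x] norm_mult)
  have xs: "(\<lambda>i. x (s i)) \<in> carrier ell2"
    using x by (simp add: ell2_reindex(1)[OF assms(1)])
  show "wperm a s x \<in> carrier ell2"
    by (rule ell2_hnorm_mult_le(1)[OF xs le C])
  show "hnorm ell2 (wperm a s x) \<le> C * hnorm ell2 x"
    using ell2_hnorm_mult_le(2)[OF xs le C] by (simp add: ell2_reindex(2)[OF assms(1)])
qed

lemma wperm_bounded_op:
  assumes "bij s" "\<And>i. \<bar>a i\<bar> \<le> C"
  shows "wperm a s \<in> bounded_ops ell2"
  unfolding bounded_ops_def mem_Collect_eq
proof (intro conjI ballI allI exI[of _ C])
  show "wperm a s \<in> carrier ell2 \<rightarrow>\<^sub>E carrier ell2"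
    using wperm_closed(1)[OF assms] by (auto simp: wperm_def)
  show "wperm a s (x \<oplus>\<^bsub>ell2\<^esub> y) = wperm a s x \<oplus>\<^bsub>ell2\<^esub> wperm a s y"
    if "x \<in> carrier ell2" "y \<in> carrier ell2" for x y
    using that by (simp add: wperm_apply ell2_add_closed distrib_left)
  show "wperm a s (z \<odot>\<^bsub>ell2\<^esub> x) = z \<odot>\<^bsub>ell2\<^esub> wperm a s x" if "x \<in> carrier ell2" for z x
    using that by (simp add: wperm_apply ell2_smult_closed mult.left_commute)
  show "hnorm ell2 (wperm a s x) \<le> C * hnorm ell2 x" if "x \<in> carrier ell2" for x
    by (rule wperm_closed(2)[OF assms that])
qed

text \<open>Pulling back reverses the order of the permutations. The assumptions on \<open>t\<close>
  and \<open>b\<close> keep the inner value in the carrier, where the outer operator is given by its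
  formula.\<close>

lemma wperm_compose:
  assumes "bij t" "\<And>i. \<bar>b i\<bar> \<le> C"
  shows "compose (carrier ell2) (wperm a s) (wperm b t) = wperm (\<lambda>i. a i * b (s i)) (t \<circ> s)"
proof
  show "compose (carrier ell2) (wperm a s) (wperm b t) x = wperm (\<lambda>i. a i * b (s i)) (t \<circ> s) x" for x
    using wperm_closed(1)[OF assms(1), of b C x] assms(2)
    by (simp add: compose_def wperm_def mult.assoc)
qed

lemma wperm_one_id: "wperm (\<lambda>i. 1) id = op_id ell2"
  by (simp add: wperm_def op_id_def)

lemma wperm_invertible:
  assumes s: "bij s" and c: "0 < c" "\<And>i. c \<le> a i" and C: "\<And>i. a i \<le> C"
  shows "op_invertible ell2 (wperm a s)"
proof -
  \<comment> \<open>The weights of the inverse along the inverse permutation, chosen so that the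
    products in \<open>wperm_compose\<close> cancel; the lower bound \<open>c\<close> keeps them
    bounded by \<open>1 / c\<close>.\<close>
  define b where "b i = 1 / a (inv_into UNIV s i)" for i
  have a: "0 < a i" for i
    using c less_le_trans by blast
  have aC: "\<bar>a i\<bar> \<le> C" for i
    using a[of i] C[of i] by simp
  have bC: "\<bar>b i\<bar> \<le> 1 / c" for i
    using c a[of "inv_into UNIV s i"] by (simp add: b_def frac_le)
  have si: "bij (inv_into UNIV s)" "s \<circ> inv_into UNIV s = id" "inv_into UNIV s \<circ> s = id" and ss: "\<And>i. inv_into UNIV s (s i) = i"
    using s by (simp_all add: bij_imp_bij_inv bij_is_surj bij_is_inj surj_iff[symmetric])
  have an: "a i \<noteq> 0" for i
    using a[of i] by simp
  have "compose (carrier ell2) (wperm b (inv_into UNIV s)) (wperm a s) = op_id ell2"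
    by (simp add: wperm_compose[OF s aC] b_def an si wperm_one_id)
  moreover have "compose (carrier ell2) (wperm a s) (wperm b (inv_into UNIV s)) = op_id ell2"
    by (simp add: wperm_compose[OF si(1) bC] b_def ss an si wperm_one_id)
  ultimately show ?thesis
    unfolding op_invertible_def using wperm_bounded_op[OF s, of a, OF aC] wperm_bounded_op[OF si(1), of b, OF bC] by blast
qed

lemma wperm_hnorm_ge:
  assumes s: "bij s" and c: "0 < c" "\<And>i. c \<le> a i" and C: "\<And>i. a i \<le> C" and x: "x \<in> carrier ell2"
  shows "c * hnorm ell2 x \<le> hnorm ell2 (wperm a s x)"
proof -
  have a: "0 < a i" for i
    using c less_le_trans by blast
  have "\<bar>a i\<bar> \<le> C" for i
    using a[of i] C[of i] by simp
  from wperm_closed(1)[OF s this x] have w: "wperm a s x \<in> carrier ell2" .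
  have "cmod (x (s i)) \<le> 1 / c * cmod (wperm a s x i)" for i
    using mult_right_mono[OF c(2)[of i], of "cmod (x (s i))"] a[of i] c
    by (simp add: wperm_apply[OF x] norm_mult field_simps)
  from ell2_hnorm_mult_le(2)[OF w this] show ?thesis
    using c by (simp add: ell2_reindex(2)[OF s] field_simps)
qed

section \<open>Adjoint, square root, modulus and polar factor of weighted permutations\<close>

text \<open>Reindexing the inner product along \<open>s\<close> moves permutation and weight to the
  other argument; the weights are real, so conjugation leaves them alone. Any other adjoint agrees
  by pairing with unit vectors.\<close>

lemma op_adjoint_wperm:
  assumes s: "bij s" and C: "\<And>i. \<bar>a i\<bar> \<le> C"
  shows "op_adjoint ell2 (wperm a s) = wperm (\<lambda>i. a (inv_into UNIV s i)) (inv_into UNIV s)"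
  unfolding op_adjoint_def
proof (rule the_equality)
  have si: "bij (inv_into UNIV s)" and ss: "\<And>i. inv_into UNIV s (s i) = i"
    using s by (simp_all add: bij_imp_bij_inv bij_is_inj)
  let ?A = "wperm (\<lambda>i. a (inv_into UNIV s i)) (inv_into UNIV s)"
  have adj: "iprod ell2 (wperm a s x) y = iprod ell2 x (?A y)"
    if "x \<in> carrier ell2" "y \<in> carrier ell2" for x y
  proof -
    have "iprod ell2 x (?A y) = (\<Sum>\<^sub>\<infinity>i. x (s i) * cnj (?A y (s i)))"
      unfolding ell2_iprod using s
      by (rule infsum_reindex_bij_betw[of s UNIV UNIV "\<lambda>i. x i * cnj (?A y i)", symmetric])
    then show ?thesis
      using that by (simp add: ell2_iprod wperm_apply ss mult_ac)
  qed
  then show "?A \<in> bounded_ops ell2 \<and>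
      (\<forall>x\<in>carrier ell2. \<forall>y\<in>carrier ell2. iprod ell2 (wperm a s x) y = iprod ell2 x (?A y))"
    using wperm_bounded_op[OF si, of "\<lambda>i. a (inv_into UNIV s i)", OF C] by blast
  fix S
  assume S: "S \<in> bounded_ops ell2 \<and>
      (\<forall>x\<in>carrier ell2. \<forall>y\<in>carrier ell2. iprod ell2 (wperm a s x) y = iprod ell2 x (S y))"
  show "S = ?A"
  proof (rule extensionalityI)
    show "S \<in> extensional (carrier ell2)"
      using S ell2.bounded_ops_D(5) by blast
    show "?A \<in> extensional (carrier ell2)"
      by (simp add: wperm_def)
    show "S y = ?A y" if y: "y \<in> carrier ell2" for y
    proof
      fix j
      have "S y \<in> carrier ell2" "?A y \<in> carrier ell2"
        using y S ell2.bounded_ops_D(1) wperm_closed(1)[OF si, of "\<lambda>i. a (inv_into UNIV s i)", OF C] by blast+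
      moreover have "iprod ell2 (unit_vec j) (S y) = iprod ell2 (unit_vec j) (?A y)"
        using S adj y unit_vec_carrier by metis
      ultimately have "iprod ell2 (S y) (unit_vec j) = iprod ell2 (?A y) (unit_vec j)"
        by (metis ell2.iprod_commute unit_vec_carrier)
      then show "S y j = ?A y j"
        by (simp add: iprod_unit_vec)
    qed
  qed
qed

text \<open>If \<open>S\<close> is another positive square root, then \<open>y = S e\<^sub>j - \<surd>d\<^sub>j e\<^sub>j\<close> satisfies
  \<open>S y = - \<surd>d\<^sub>j y\<close>, and positivity of \<open>S\<close> forces \<open>y = 0\<close>.\<close>

lemma op_sqrt_wperm_id:
  assumes d: "\<And>i. 0 < d i" and C: "\<And>i. d i \<le> C"
  shows "op_sqrt ell2 (wperm d id) = wperm (\<lambda>i. sqrt (d i)) id"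
  unfolding op_sqrt_def
proof (rule the_equality)
  let ?R = "wperm (\<lambda>i. sqrt (d i)) id"
  have C': "\<bar>sqrt (d i)\<bar> \<le> sqrt C" for i
    using d[of i] C[of i] by simp
  have "compose (carrier ell2) ?R ?R = wperm d id"
    using d by (simp add: wperm_compose[OF bij_id C'] less_imp_le)
  moreover have "iprod ell2 (?R x) x \<in> \<real>\<^sub>\<ge>\<^sub>0" if "x \<in> carrier ell2" for x
  proof -
    have "iprod ell2 (?R x) x = complex_of_real (\<Sum>\<^sub>\<infinity>i. sqrt (d i) * (cmod (x i))\<^sup>2)"
      using that by (simp add: ell2_iprod wperm_apply mult.assoc
          flip: infsum_complex_of_real complex_norm_square)
    then show ?thesis
      using d by (simp add: infsum_nonneg less_imp_le)
  qed
  ultimately show "positive_op ell2 ?R \<and> compose (carrier ell2) ?R ?R = wperm d id"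
    using wperm_bounded_op[OF bij_id C'] by (simp add: positive_op_def)
  fix S
  assume "positive_op ell2 S \<and> compose (carrier ell2) S S = wperm d id"
  then have S: "positive_op ell2 S" and SS: "compose (carrier ell2) S S = wperm d id"
    by auto
  have Sb: "S \<in> bounded_ops ell2"
    using S by (simp add: positive_op_def)
  note Sc = ell2.bounded_ops_D(1)[OF Sb]
  have eigen: "S (unit_vec j) = sqrt (d j) \<odot>\<^bsub>ell2\<^esub> unit_vec j" for j
  proof -
    define r where "r = sqrt (d j)"
    have r: "r > 0" "r * r = d j"
      using d[of j] by (simp_all add: r_def)
    define y where "y = S (unit_vec j) \<ominus>\<^bsub>ell2\<^esub> (r \<odot>\<^bsub>ell2\<^esub> unit_vec j)"
    have y: "y \<in> carrier ell2"
      unfolding y_def by (intro ell2.M.minus_closed Sc ell2.smult_in_carrier unit_vec_carrier)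
    have "S (S (unit_vec j)) = wperm d id (unit_vec j)"
      using fun_cong[OF SS, of "unit_vec j"] unit_vec_carrier[of j] by (simp add: compose_def)
    also have "\<dots> = (\<lambda>i. r * (r * unit_vec j i))"
      by (simp only: wperm_apply[OF unit_vec_carrier])
        (simp add: unit_vec_def fun_eq_iff r flip: of_real_mult)
    finally have "S (S (unit_vec j)) = (\<lambda>i. r * (r * unit_vec j i))" .
    then have "S y = (- r) \<odot>\<^bsub>ell2\<^esub> y"
      unfolding y_def
      using ell2.bounded_ops_diff[OF Sb, of "S (unit_vec j)" "r \<odot>\<^bsub>ell2\<^esub> unit_vec j"]
        ell2.bounded_ops_D(3)[OF Sb, of "unit_vec j" r]
      by (simp add: Sc unit_vec_carrier ell2_minus ell2_smult_closed algebra_simps)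
    then have "iprod ell2 (S y) y = - complex_of_real r * iprod ell2 y y"
      using ell2.iprod_smult_left[OF y y, of "-r"] by simp
    also have "\<dots> = complex_of_real (- (r * (hnorm ell2 y)\<^sup>2))"
      by (simp add: ell2.iprod_self_of_real[OF y])
    finally have "complex_of_real (- (r * (hnorm ell2 y)\<^sup>2)) \<in> \<real>\<^sub>\<ge>\<^sub>0"
      using S y by (auto simp: positive_op_def)
    then have "r * (hnorm ell2 y)\<^sup>2 \<le> 0"
      unfolding nonneg_Reals_of_real_iff by simp
    then have "hnorm ell2 y = 0"
      using r by (simp add: mult_le_0_iff)
    then have "y = \<zero>\<^bsub>ell2\<^esub>"
      using ell2.hnorm_eq_0_iff[OF y] by blast
    then show ?thesis
      unfolding y_def r_def
      by (rule ell2.eq_if_diff_eq_zero[rotated 2]) (simp_all add: Sc unit_vec_carrier ell2_smult_closed)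
  qed
  show "S = ?R"
  proof (rule extensionalityI)
    show "S \<in> extensional (carrier ell2)"
      by (rule ell2.bounded_ops_D(5)[OF Sb])
    show "?R \<in> extensional (carrier ell2)"
      by (simp add: wperm_def)
    show "S x = ?R x" if x: "x \<in> carrier ell2" for x
    proof
      fix j
      \<comment> \<open>Symmetry moves \<open>S\<close> onto the basis vector, so the eigenvector
        equation determines every coordinate of \<open>S x\<close>.\<close>
      have "S x j = iprod ell2 x (S (unit_vec j))"
        using ell2.positive_op_symmetric[OF S x unit_vec_carrier] by (simp add: iprod_unit_vec)
      also have "\<dots> = sqrt (d j) * x j"
        unfolding eigen using ell2.iprod_smult_right[OF unit_vec_carrier x]
        by (simp add: iprod_unit_vec)
      finally show "S x j = ?R x j"
        by (simp add: wperm_apply[OF x])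
    qed
  qed
qed

text \<open>In the product of the adjoint with the operator the two permutations cancel, which
  leaves a diagonal operator with squared weights. Positivity makes the root of each square the
  weight itself.\<close>

lemma op_abs_wperm:
  assumes s: "bij s" and a: "\<And>i. 0 < a i" and C: "\<And>i. a i \<le> C"
  shows "op_abs ell2 (wperm a s) = wperm (\<lambda>i. a (inv_into UNIV s i)) id"
proof -
  let ?t = "inv_into UNIV s"
  have aC: "\<bar>a i\<bar> \<le> C" for i
    using a[of i] C[of i] by simp
  have "s \<circ> ?t = id"
    using s by (simp add: bij_is_surj surj_iff[symmetric])
  then have TT: "compose (carrier ell2) (op_adjoint ell2 (wperm a s)) (wperm a s)
      = wperm (\<lambda>i. a (?t i) * a (?t i)) id"
    by (simp add: op_adjoint_wperm[OF s aC] wperm_compose[OF s aC])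
  have "op_sqrt ell2 (wperm (\<lambda>i. a (?t i) * a (?t i)) id) = wperm (\<lambda>i. sqrt (a (?t i) * a (?t i))) id"
  proof (rule op_sqrt_wperm_id)
    show "0 < a (?t i) * a (?t i)" for i
      using a by simp
    show "a (?t i) * a (?t i) \<le> C * C" for i
      using a[of "?t i"] C[of "?t i"] by (intro mult_mono) auto
  qed
  then show ?thesis
    using a by (simp add: op_abs_def TT less_imp_le)
qed

text \<open>The lower norm bound excludes nonzero kernel vectors. All kernel conditions in
  \<open>polar_factor\<close> thereby become equalities of trivial subspaces.\<close>

lemma op_ker_wperm:
  assumes "bij s" "0 < c" "\<And>i. c \<le> a i" "\<And>i. a i \<le> C"
  shows "op_ker ell2 (wperm a s) = {\<zero>\<^bsub>ell2\<^esub>}"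
proof -
  have "x = \<zero>\<^bsub>ell2\<^esub>" if x: "x \<in> carrier ell2" and "wperm a s x = \<zero>\<^bsub>ell2\<^esub>" for x
  proof -
    have "c * hnorm ell2 x \<le> 0"
      using wperm_hnorm_ge[of s c a C, OF assms x] that by (simp add: ell2_hnorm_zero)
    then show ?thesis
      using ell2.hnorm_eq_0_iff[OF x] ell2_hnorm_nonneg[of x] \<open>0 < c\<close> by (simp add: mult_le_0_iff)
  qed
  moreover have "wperm a s \<zero>\<^bsub>ell2\<^esub> = \<zero>\<^bsub>ell2\<^esub>"
    by (simp add: wperm_apply ell2_zero_carrier)
  ultimately show ?thesis
    unfolding op_ker_def using ell2.M.zero_closed by blast
qed

text \<open>Stripping the weights leaves an isometry whose product with the diagonal modulus is the
  given operator. It is the only candidate because the modulus is invertible and can be cancelled on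
  the right.\<close>

lemma polar_factor_wperm:
  assumes s: "bij s" and c: "0 < c" "\<And>i. c \<le> a i" and C: "\<And>i. a i \<le> C"
  shows "polar_factor ell2 (wperm a s) = wperm (\<lambda>i. 1) s"
  unfolding polar_factor_def
proof (rule the_equality)
  let ?U = "wperm (\<lambda>i. 1) s" and ?P = "wperm (\<lambda>i. a (inv_into UNIV s i)) id"
  have a: "0 < a i" for i
    using c less_le_trans by blast
  have aC: "\<bar>a i\<bar> \<le> C" for i
    using a[of i] C[of i] by simp
  have P: "op_abs ell2 (wperm a s) = ?P"
    by (rule op_abs_wperm[OF s a C])
  have UP: "compose (carrier ell2) ?U ?P = wperm a s"
    using s by (simp add: wperm_compose[OF bij_id, of "\<lambda>i. a (inv_into UNIV s i)", OF aC] bij_is_inj)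
  have ker: "op_ker ell2 ?U = {\<zero>\<^bsub>ell2\<^esub>}" "op_ker ell2 (wperm a s) = {\<zero>\<^bsub>ell2\<^esub>}"
    "op_ker ell2 ?P = {\<zero>\<^bsub>ell2\<^esub>}"
    using op_ker_wperm[OF s, of 1 "\<lambda>i. 1" 1] op_ker_wperm[OF s c C]
      op_ker_wperm[OF bij_id c(1), of "\<lambda>i. a (inv_into UNIV s i)" C] c C by auto
  have "partial_isometry ell2 ?U"
    unfolding partial_isometry_def using wperm_bounded_op[OF s, of "\<lambda>i. 1" 1]
    by (simp add: wperm_apply ell2_reindex(2)[OF s])
  then show "partial_isometry ell2 ?U \<and> wperm a s = compose (carrier ell2) ?U (op_abs ell2 (wperm a s)) \<and>
      op_ker ell2 ?U = op_ker ell2 (wperm a s) \<and>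
      op_ker ell2 (wperm a s) = op_ker ell2 (op_abs ell2 (wperm a s))"
    by (simp add: P UP ker)
  fix V
  assume V: "partial_isometry ell2 V \<and> wperm a s = compose (carrier ell2) V (op_abs ell2 (wperm a s)) \<and>
      op_ker ell2 V = op_ker ell2 (wperm a s) \<and>
      op_ker ell2 (wperm a s) = op_ker ell2 (op_abs ell2 (wperm a s))"
  have "op_invertible ell2 ?P"
    by (rule wperm_invertible[OF bij_id c(1)]) (use c C in auto)
  then obtain Q where Q: "Q \<in> bounded_ops ell2" and PQ: "compose (carrier ell2) ?P Q = op_id ell2"
    unfolding op_invertible_def by blast
  show "V = ?U"
  proof (rule extensionalityI)
    show "V \<in> extensional (carrier ell2)"
      using V ell2.bounded_ops_D(5) by (auto simp: partial_isometry_def)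
    show "?U \<in> extensional (carrier ell2)"
      by (simp add: wperm_def)
    show "V x = ?U x" if x: "x \<in> carrier ell2" for x
    proof -
      have Qx: "Q x \<in> carrier ell2"
        by (rule ell2.bounded_ops_D(1)[OF Q x])
      have "?P (Q x) = x"
        using fun_cong[OF PQ, of x] x by (simp add: compose_def op_id_def)
      moreover have "compose (carrier ell2) V ?P (Q x) = compose (carrier ell2) ?U ?P (Q x)"
        using V by (simp add: P UP)
      ultimately show ?thesis
        using Qx by (simp add: compose_def)
    qed
  qed
qed

subsection \<open>Aluthge iterates of weighted permutations\<close>

text \<open>The action of the Aluthge transform on weights: the geometric mean of a weight and its
  predecessor along \<open>s\<close>. The two roots are kept apart as they arise from the two outer
  factors.\<close>

definition geo_avg :: "('i \<Rightarrow> 'i) \<Rightarrow> ('i \<Rightarrow> real) \<Rightarrow> 'i \<Rightarrow> real" where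
  "geo_avg s a i = sqrt (a (inv_into UNIV s i)) * sqrt (a i)"

text \<open>The root of the modulus has entries \<open>sqrt (a (inv_into UNIV s i))\<close>.
  Composed on the right of the permutation it is evaluated at \<open>s i\<close> and yields
  \<open>sqrt (a i)\<close>; on the left it enters unshifted.\<close>

lemma aluthge_wperm:
  assumes s: "bij s" and c: "0 < c" "\<And>i. c \<le> a i" and C: "\<And>i. a i \<le> C"
  shows "aluthge ell2 (wperm a s) = wperm (geo_avg s a) s"
proof -
  let ?t = "inv_into UNIV s"
  have a: "0 < a i" for i
    using c less_le_trans by blast
  have aC: "\<bar>sqrt (a i)\<bar> \<le> sqrt C" for i
    using a[of i] C[of i] by simp
  have R: "op_sqrt ell2 (op_abs ell2 (wperm a s)) = wperm (\<lambda>i. sqrt (a (?t i))) id"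
    unfolding op_abs_wperm[OF s a C] by (rule op_sqrt_wperm_id[OF a C])
  have "compose (carrier ell2) (wperm (\<lambda>i. 1) s) (wperm (\<lambda>i. sqrt (a (?t i))) id)
      = wperm (\<lambda>i. sqrt (a i)) s"
    using s by (simp add: wperm_compose[OF bij_id, of "\<lambda>i. sqrt (a (?t i))", OF aC] bij_is_inj)
  then show ?thesis
    unfolding aluthge_def Let_def R polar_factor_wperm[OF s c C]
    by (simp add: wperm_compose[OF s, of "\<lambda>i. sqrt (a i)", OF aC] geo_avg_def[abs_def])
qed

lemma geo_avg_bounds:
  assumes "0 < c" "\<And>i. c \<le> a i" "\<And>i. a i \<le> C"
  shows "c \<le> geo_avg s a i" and "geo_avg s a i \<le> C"
proof -
  have a: "0 < a i" for i
    using assms(1,2) less_le_trans by blast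
  have "0 < C"
    using a assms(3) by (rule less_le_trans)
  have "sqrt c * sqrt c \<le> geo_avg s a i"
    unfolding geo_avg_def using assms a by (intro mult_mono real_sqrt_le_mono) (simp_all add: less_imp_le)
  then show "c \<le> geo_avg s a i"
    using \<open>0 < c\<close> by simp
  have "geo_avg s a i \<le> sqrt C * sqrt C"
    unfolding geo_avg_def using assms a \<open>0 < C\<close>
    by (intro mult_mono real_sqrt_le_mono) (simp_all add: less_imp_le)
  then show "geo_avg s a i \<le> C"
    using \<open>0 < C\<close> by simp
qed

lemma geo_avg_iterate_bounds:
  assumes "0 < c" "\<And>i. c \<le> a i" "\<And>i. a i \<le> C"
  shows "c \<le> (geo_avg s ^^ n) a i" and "(geo_avg s ^^ n) a i \<le> C"
proof -
  have "\<forall>i. c \<le> (geo_avg s ^^ n) a i \<and> (geo_avg s ^^ n) a i \<le> C"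
  proof (induction n)
    case (Suc n)
    then show ?case
      using geo_avg_bounds[OF assms(1), of "(geo_avg s ^^ n) a" C] by simp
  qed (simp add: assms)
  then show "c \<le> (geo_avg s ^^ n) a i" "(geo_avg s ^^ n) a i \<le> C"
    by simp_all
qed

text \<open>The bounds \<open>c\<close> and \<open>C\<close> pass to every iterate, so
  \<open>aluthge_wperm\<close> applies again at each step.\<close>

lemma aluthge_iterate_wperm:
  assumes s: "bij s" and c: "0 < c" "\<And>i. c \<le> a i" and C: "\<And>i. a i \<le> C"
  shows "(aluthge ell2 ^^ n) (wperm a s) = wperm ((geo_avg s ^^ n) a) s"
proof (induction n)
  case (Suc n)
  then show ?case
    using aluthge_wperm[OF s c(1), of "(geo_avg s ^^ n) a" C] geo_avg_iterate_bounds[of c a C, where s = s and n = n] c C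
    by simp
qed simp

text \<open>Each weight is a matrix entry of its operator, and the operator norm bounds all matrix
  entries at once, hence uniformly in the index.\<close>

lemma wperm_norm_convergent_imp_uniform_limit:
  assumes s: "bij s" and C: "\<And>n i. \<bar>w n i\<bar> \<le> C" and conv: "norm_convergent ell2 (\<lambda>n. wperm (w n) s)"
  obtains u where "uniform_limit UNIV w u sequentially"
proof -
  obtain L where L: "L \<in> bounded_ops ell2"
    and lim: "(\<lambda>n. op_norm ell2 (op_diff ell2 (wperm (w n) s) L)) \<longlonglongrightarrow> 0"
    using conv unfolding norm_convergent_def by blast
  \<comment> \<open>The entry of \<open>L\<close> in the position where \<open>wperm (w n) s\<close>
    has \<open>w n k\<close>. The real part is taken because \<open>L\<close> could a priori have
    complex entries.\<close>
  define u where "u k = Re (L (unit_vec (s k)) k)" for k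
  have le: "dist (w n k) (u k) \<le> op_norm ell2 (op_diff ell2 (wperm (w n) s) L)" for n k
  proof -
    let ?D = "op_diff ell2 (wperm (w n) s) L" and ?e = "unit_vec (s k)"
    have D: "?D \<in> bounded_ops ell2"
      by (intro ell2.op_diff_bounded L wperm_bounded_op[OF s C])
    have "?D ?e k = w n k - L ?e k"
      using unit_vec_carrier[of "s k"] ell2.bounded_ops_D(1)[OF L unit_vec_carrier[of "s k"]]
      by (simp add: op_diff_def ell2_minus wperm_apply) (simp add: unit_vec_def)
    then have "dist (w n k) (u k) \<le> cmod (?D ?e k)"
      using abs_Re_le_cmod[of "?D ?e k"] by (simp add: u_def dist_real_def)
    also have "\<dots> \<le> hnorm ell2 (?D ?e)"
      by (intro ell2_cmod_le ell2.bounded_ops_D(1)[OF D] unit_vec_carrier)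
    also have "\<dots> \<le> op_norm ell2 ?D"
      by (intro ell2.hnorm_le_op_norm D unit_vec_carrier) (simp add: hnorm_unit_vec)
    finally show ?thesis .
  qed
  have "uniform_limit UNIV w u sequentially"
  proof (rule uniform_limitI)
    fix e :: real assume "e > 0"
    with lim have "\<forall>\<^sub>F n in sequentially. op_norm ell2 (op_diff ell2 (wperm (w n) s) L) < e"
      by (rule order_tendstoD)
    then show "\<forall>\<^sub>F n in sequentially. \<forall>x\<in>UNIV. dist (w n x) (u x) < e"
      by eventually_elim (use le in \<open>blast intro: le_less_trans\<close>)
  qed
  then show thesis
    by (rule that)
qed

subsection \<open>A step-weighted bilateral shift\<close>

text \<open>The bilateral shift, moved from the integers to \<^typ>\<open>nat\<close>: iterating \<open>zshift\<close> runs through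
  \<open>\<dots>, 4, 2, 0, 1, 3, 5, \<dots>\<close>.\<close>

definition zshift :: "nat \<Rightarrow> nat" where
  "zshift i = (if odd i then i + 2 else if i = 0 then 1 else i - 2)"

definition zshift_inv :: "nat \<Rightarrow> nat" where
  "zshift_inv i = (if even i then i + 2 else if i = 1 then 0 else i - 2)"

lemma zshift_zshift_inv: "zshift (zshift_inv i) = i"
  and zshift_inv_zshift: "zshift_inv (zshift i) = i"
  unfolding zshift_def zshift_inv_def by presburger+

lemma bij_zshift: "bij zshift"
  by (rule o_bij[of zshift_inv]) (auto simp: zshift_zshift_inv zshift_inv_zshift)

lemma inv_zshift: "inv_into UNIV zshift = zshift_inv"
  by (rule inv_unique_comp) (auto simp: zshift_zshift_inv zshift_inv_zshift)

text \<open>In orbit order the weights read ..., 4, 4, 4, 2, 2, 2, ..., with the jump between the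
  indices 0 and 1.\<close>

definition step_weight :: "nat \<Rightarrow> real" where
  "step_weight i = (if even i then 4 else 2)"

text \<open>The predecessor of an even index is even, so only values 4 are ever averaged on this
  half of the orbit.\<close>

lemma geo_avg_iterate_even: "even i \<Longrightarrow> (geo_avg zshift ^^ n) step_weight i = 4"
proof (induction n arbitrary: i)
  case (Suc n)
  then show ?case
    by (simp add: geo_avg_def inv_zshift zshift_inv_def)
qed (simp add: step_weight_def)

text \<open>Each averaging carries the influence of the weight 4 one place further along 1, 3, 5,
  ...; after \<open>n\<close> rounds it has reached at most the index
  \<open>2 * n - 1\<close>.\<close>

lemma geo_avg_iterate_odd: "odd i \<Longrightarrow> 2 * n < i \<Longrightarrow> (geo_avg zshift ^^ n) step_weight i = 2"
proof (induction n arbitrary: i)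
  case (Suc n)
  then show ?case
    by (simp add: geo_avg_def inv_zshift zshift_inv_def)
qed (simp add: step_weight_def)

text \<open>The shift has a single orbit, so an invariant function is constant.\<close>

lemma zshift_inv_invariant_constant:
  assumes inv: "\<And>i. u (zshift_inv i) = u i"
  shows "u i = u 0"
proof (induction i rule: less_induct)
  case (less i)
  consider "i = 0" | "i = 1" | j where "i = j + 2"
    by (metis One_nat_def add_2_eq_Suc' not0_implies_Suc)
  then show ?case
  proof cases
    case 2
    then show ?thesis
      using inv[of 1] by (simp add: zshift_inv_def)
  next
    case (3 j)
    then have "u i = u j"
      \<comment> \<open>For even \<open>j\<close> the inverse shift takes \<open>j\<close> to
        \<open>i\<close>, for odd \<open>j\<close> it takes \<open>i\<close> to
        \<open>j\<close>.\<close>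
      using inv[of i] inv[of j] by (auto simp: zshift_inv_def split: if_splits)
    then show ?thesis
      using less[of j] 3 by simp
  qed simp
qed

lemma not_uniform_limit_geo_avg_iterate:
  "\<not> uniform_limit UNIV (\<lambda>n. (geo_avg zshift ^^ Suc n) step_weight) u sequentially"
proof
  define w where "w n = (geo_avg zshift ^^ Suc n) step_weight" for n
  assume "uniform_limit UNIV (\<lambda>n. (geo_avg zshift ^^ Suc n) step_weight) u sequentially"
  then have unif: "uniform_limit UNIV w u sequentially"
    by (simp add: w_def[abs_def])
  have w: "2 \<le> w n i" for n i
    using geo_avg_iterate_bounds[of 2 step_weight 4, where s = zshift and n = "Suc n" and i = i]
    by (simp add: w_def step_weight_def)
  have lim: "(\<lambda>n. w n i) \<longlonglongrightarrow> u i" for i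
    by (rule tendsto_uniform_limitI[OF unif]) simp
  have "u (zshift_inv i) = u i" for i
  proof -
    have "w (Suc n) i = sqrt (w n (zshift_inv i)) * sqrt (w n i)" for n
      by (simp add: w_def geo_avg_def inv_zshift)
    then have "(\<lambda>n. w (Suc n) i) \<longlonglongrightarrow> sqrt (u (zshift_inv i)) * sqrt (u i)"
      by (simp only:) (intro tendsto_intros lim)
    then have eq: "u i = sqrt (u (zshift_inv i)) * sqrt (u i)"
      using LIMSEQ_unique LIMSEQ_Suc[OF lim] by blast
    have "2 \<le> u i"
      using w by (intro LIMSEQ_le_const[OF lim]) auto
    then have "sqrt (u i) * sqrt (u i) = u i"
      by simp
    also note eq
    \<comment> \<open>The factor \<open>sqrt (u i)\<close> may be cancelled because the lower bound
      2 on the weights persists in the limit.\<close>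
    finally have "sqrt (u i) = sqrt (u (zshift_inv i))"
      using \<open>2 \<le> u i\<close> by (subst (asm) mult_right_cancel) simp_all
    then show ?thesis
      by simp
  qed
  then have const: "u i = u 0" for i
    by (rule zshift_inv_invariant_constant)
  \<comment> \<open>The radius 1 is half the gap between the weights 4 and 2. Uniformity lets one
    \<open>n\<close> serve both ends of the orbit.\<close>
  obtain n where n: "\<And>i. dist (w n i) (u i) < 1"
    using uniform_limitD[OF unif, of 1] unfolding eventually_sequentially by auto
  have "dist 4 (u 0) < 1"
    using n[of 0] geo_avg_iterate_even[of 0 "Suc n"] by (simp add: w_def)
  moreover have "dist 2 (u 0) < 1"
    \<comment> \<open>Since \<open>w n\<close> is the iterate of order \<open>Suc n\<close>, the
      index \<open>2 * n + 3\<close> is the least odd one to which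
      \<open>geo_avg_iterate_odd\<close> applies.\<close>
    using n[of "2 * n + 3"] geo_avg_iterate_odd[of "2 * n + 3" "Suc n"] const[of "2 * n + 3"]
    by (simp add: w_def)
  ultimately show False
    by (simp add: dist_real_def)
qed

theorem theorem2p8:
  shows "\<exists>(H :: (nat \<Rightarrow> complex) complex_inner_module) T.
           complex_hilbert_space H \<and>
           T \<in> bounded_ops H \<and> hyperbolic H T \<and>
           \<not> norm_convergent H (\<lambda>n. (aluthge H ^^ Suc n) T)"
proof (intro exI conjI)
  let ?T = "wperm step_weight zshift"
  have c: "2 \<le> step_weight i" and C: "step_weight i \<le> 4" for i
    by (simp_all add: step_weight_def)
  show "complex_hilbert_space (ell2 :: (nat \<Rightarrow> complex) complex_inner_module)"
    by (rule complex_hilbert_space_ell2)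
  have T: "op_invertible ell2 ?T"
    using c C by (intro wperm_invertible[of _ 2 _ 4] bij_zshift) auto
  then show "?T \<in> bounded_ops ell2"
    by (simp add: op_invertible_def)
  show "hyperbolic ell2 ?T"
    using c C by (intro complex_hilbert_space.hyperbolic_if_expanding[OF complex_hilbert_space_ell2 T, of 2]
        wperm_hnorm_ge[of _ 2 _ 4] bij_zshift) auto
  show "\<not> norm_convergent ell2 (\<lambda>n. (aluthge ell2 ^^ Suc n) ?T)"
  proof
    assume "norm_convergent ell2 (\<lambda>n. (aluthge ell2 ^^ Suc n) ?T)"
    then have conv: "norm_convergent ell2 (\<lambda>n. wperm ((geo_avg zshift ^^ Suc n) step_weight) zshift)"
      by (simp only: aluthge_iterate_wperm[of zshift 2 step_weight 4, OF bij_zshift _ c C] zero_less_numeral)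
    have bound: "\<bar>(geo_avg zshift ^^ Suc n) step_weight i\<bar> \<le> 4" for n i
      using geo_avg_iterate_bounds[of 2 step_weight 4, where s = zshift and n = "Suc n" and i = i] c C by simp
    show False
      using wperm_norm_convergent_imp_uniform_limit[OF bij_zshift bound conv]
        not_uniform_limit_geo_avg_iterate by blast
  qed
qed

end
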